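(* Let $G$ be a countable group. Then $$\operatorname{asdim} G=\sup \operatorname{asdim} F,$$ where the supremum is taken over all finitely generated subgroups $F$ of $G$.
   Context: Asymptotic dimension of a metric space: a metric space $X$ has $\operatorname{asdim} X\le n$ if for every $d>0$ there are $R$ and $n+1$ families $\mathcal U_0,\dots,\mathcal U_n$ of subsets of $X$ whose union covers $X$, such that each $\mathcal U_i$ is $R$-bounded (every member has diameter at most $R$) and $d$-disjoint (the distance between $x\in U$ and $y\in V$ is $>d$ whenever $U\ne V$ are members of $\mathcal U_i$). $\operatorname{asdim}X$ is the least such $n$, or $\infty$ if none exists. A metric $d$ on a group is left invariant if $d(gx,gy)=d(x,y)$ for all $g,x,y$, and proper if all closed balls are compact. In this statement, for a countable (discrete) group $G$ (finitely generated or not), $\operatorname{asdim} G$ means the asymptotic dimension of the metric space $(G,d)$, where $d$ is any proper left invariant metric on $G$ (all closed balls finite); such a metric exists and the value does not depend on its choice. For a finitely generated group, the word metric of a finite generating set is such a metric. *)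

theory Defs
  imports
    "HOL-Algebra.Generated_Groups"
    "HOL-Analysis.Abstract_Metric_Spaces"
    "HOL-Library.Extended_Nat"
begin

definition bounded_family :: "('a \<Rightarrow> 'a \<Rightarrow> real) \<Rightarrow> real \<Rightarrow> 'a set set \<Rightarrow> bool" where
  "bounded_family d R \<U> \<longleftrightarrow> (\<forall>A\<in>\<U>. \<forall>x\<in>A. \<forall>y\<in>A. d x y \<le> R)"

definition disjoint_family_at :: "('a \<Rightarrow> 'a \<Rightarrow> real) \<Rightarrow> real \<Rightarrow> 'a set set \<Rightarrow> bool" where
  "disjoint_family_at d r \<U> \<longleftrightarrow>
     (\<forall>A\<in>\<U>. \<forall>B\<in>\<U>. A \<noteq> B \<longrightarrow> (\<forall>x\<in>A. \<forall>y\<in>B. d x y > r))"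

definition asdim_at_most :: "'a set \<Rightarrow> ('a \<Rightarrow> 'a \<Rightarrow> real) \<Rightarrow> nat \<Rightarrow> bool" where
  "asdim_at_most M d n \<longleftrightarrow>
     (\<forall>r>0. \<exists>R. \<exists>\<U> :: nat \<Rightarrow> 'a set set.
        (\<forall>i\<le>n. \<U> i \<subseteq> Pow M \<and> bounded_family d R (\<U> i) \<and> disjoint_family_at d r (\<U> i)) \<and>
        M \<subseteq> (\<Union>i\<le>n. \<Union>(\<U> i)))"

text \<open>In \<^typ>\<open>enat\<close> the infimum of the empty set is \<open>\<infinity>\<close>, and the infimum of a nonempty set is
  its least element.\<close>

definition asdim :: "'a set \<Rightarrow> ('a \<Rightarrow> 'a \<Rightarrow> real) \<Rightarrow> enat" where
  "asdim M d = (INF n\<in>{n. asdim_at_most M d n}. enat n)"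

definition left_invariant_metric ::
  "('a, 'b) monoid_scheme \<Rightarrow> ('a \<Rightarrow> 'a \<Rightarrow> real) \<Rightarrow> bool" where
  "left_invariant_metric G d \<longleftrightarrow>
     Metric_space (carrier G) d \<and>
     (\<forall>g\<in>carrier G. \<forall>x\<in>carrier G. \<forall>y\<in>carrier G. d (g \<otimes>\<^bsub>G\<^esub> x) (g \<otimes>\<^bsub>G\<^esub> y) = d x y)"

text \<open>The groups here are discrete, so compactness of closed balls means finiteness.\<close>

definition proper_left_invariant_metric ::
  "('a, 'b) monoid_scheme \<Rightarrow> ('a \<Rightarrow> 'a \<Rightarrow> real) \<Rightarrow> bool" where
  "proper_left_invariant_metric G d \<longleftrightarrow>
     left_invariant_metric G d \<and>
     (\<forall>x\<in>carrier G. \<forall>r. finite (Metric_space.mcball (carrier G) d x r))"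

text \<open>For countable groups a metric as chosen below exists (\<open>proper_left_invariant_metric_exists\<close>),
  and every other choice gives the same value (\<open>group_asdim_eq\<close>).\<close>

definition group_asdim :: "('a, 'b) monoid_scheme \<Rightarrow> enat" where
  "group_asdim G = asdim (carrier G) (SOME d. proper_left_invariant_metric G d)"

definition finitely_generated_subgroup :: "'a set \<Rightarrow> ('a, 'b) monoid_scheme \<Rightarrow> bool" where
  "finitely_generated_subgroup F G \<longleftrightarrow>
     subgroup F G \<and> (\<exists>S. finite S \<and> S \<subseteq> carrier G \<and> F = generate G S)"

lemma proper_left_invariant_metric_bornologous:
  assumes "group G" and d: "proper_left_invariant_metric G d"
    and d': "proper_left_invariant_metric G d'"
  shows "\<exists>s>0. \<forall>x\<in>carrier G. \<forall>y\<in>carrier G. d x y \<le> r \<longrightarrow> d' x y \<le> s"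
proof -
  interpret group G by fact
  interpret d: Metric_space "carrier G" d
    using d by (simp add: proper_left_invariant_metric_def left_invariant_metric_def)
  define B where "B = d.mcball \<one>\<^bsub>G\<^esub> r"
  have "finite B"
    using d by (simp add: B_def proper_left_invariant_metric_def)
  then obtain s where s: "\<And>g. g \<in> B \<Longrightarrow> d' \<one>\<^bsub>G\<^esub> g \<le> s"
    by (metis finite_imageI bdd_above_finite bdd_above.E imageI)
  have "d' x y \<le> max s 1" if xy: "x \<in> carrier G" "y \<in> carrier G" and "d x y \<le> r" for x y
  proof -
    define g where "g = inv\<^bsub>G\<^esub> x \<otimes>\<^bsub>G\<^esub> y"
    have g: "g \<in> carrier G" "x \<otimes>\<^bsub>G\<^esub> g = y" "x \<otimes>\<^bsub>G\<^esub> \<one>\<^bsub>G\<^esub> = x"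
      using xy by (simp_all add: g_def m_assoc[symmetric])
    have "d \<one>\<^bsub>G\<^esub> g = d x y" "d' \<one>\<^bsub>G\<^esub> g = d' x y"
      using d d' g xy
      unfolding proper_left_invariant_metric_def left_invariant_metric_def
      by (metis one_closed)+
    with s[of g] that g show ?thesis by (auto simp: B_def)
  qed
  then show ?thesis by (intro exI[of _ "max s 1"]) auto
qed

lemma asdim_at_most_transfer:
  assumes G: "group G" and d: "proper_left_invariant_metric G d"
    and d': "proper_left_invariant_metric G d'" and n: "asdim_at_most (carrier G) d n"
  shows "asdim_at_most (carrier G) d' n"
  unfolding asdim_at_most_def
proof (intro allI impI)
  fix r :: real assume "r > 0"
  obtain s where "s > 0"
    and s: "\<And>x y. x \<in> carrier G \<Longrightarrow> y \<in> carrier G \<Longrightarrow> d' x y \<le> r \<Longrightarrow> d x y \<le> s"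
    using proper_left_invariant_metric_bornologous[OF G d' d] by metis
  from n \<open>s > 0\<close> obtain R \<U> where
    U: "\<And>i. i \<le> n \<Longrightarrow> \<U> i \<subseteq> Pow (carrier G) \<and> bounded_family d R (\<U> i) \<and> disjoint_family_at d s (\<U> i)"
    and cov: "carrier G \<subseteq> (\<Union>i\<le>n. \<Union>(\<U> i))"
    unfolding asdim_at_most_def by metis
  obtain R' where
    R': "\<And>x y. x \<in> carrier G \<Longrightarrow> y \<in> carrier G \<Longrightarrow> d x y \<le> R \<Longrightarrow> d' x y \<le> R'"
    using proper_left_invariant_metric_bornologous[OF G d d'] by metis
  have "bounded_family d' R' (\<U> i)" if "i \<le> n" for i
    unfolding bounded_family_def
  proof (intro ballI)
    fix A x y assume "A \<in> \<U> i" "x \<in> A" "y \<in> A"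
    with U[OF that] show "d' x y \<le> R'"
      by (intro R') (auto simp: bounded_family_def)
  qed
  moreover have "disjoint_family_at d' r (\<U> i)" if "i \<le> n" for i
    unfolding disjoint_family_at_def
  proof (intro ballI impI)
    fix A B x y assume *: "A \<in> \<U> i" "B \<in> \<U> i" "A \<noteq> B" "x \<in> A" "y \<in> B"
    with U[OF that] have "d x y > s" "x \<in> carrier G" "y \<in> carrier G"
      by (auto simp: disjoint_family_at_def)
    with s[of x y] show "d' x y > r" by force
  qed
  ultimately show "\<exists>R. \<exists>\<U> :: nat \<Rightarrow> 'a set set.
        (\<forall>i\<le>n. \<U> i \<subseteq> Pow (carrier G) \<and> bounded_family d' R (\<U> i) \<and> disjoint_family_at d' r (\<U> i)) \<and>
        carrier G \<subseteq> (\<Union>i\<le>n. \<Union>(\<U> i))"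
    using U cov by (intro exI[of _ R'] exI[of _ \<U>]) auto
qed

lemma group_asdim_eq:
  assumes "group G" and "proper_left_invariant_metric G d"
  shows "group_asdim G = asdim (carrier G) d"
proof -
  have "proper_left_invariant_metric G (SOME d. proper_left_invariant_metric G d)"
    by (rule someI[of "proper_left_invariant_metric G", OF assms(2)])
  then have "asdim_at_most (carrier G) (SOME d. proper_left_invariant_metric G d) n
      \<longleftrightarrow> asdim_at_most (carrier G) d n" for n
    using asdim_at_most_transfer[OF assms(1)] assms(2) by blast
  then show ?thesis by (simp add: group_asdim_def asdim_def)
qed

lemma proper_left_invariant_metric_exists:
  assumes "group G" and ctbl: "countable (carrier G)"
  shows "\<exists>d. proper_left_invariant_metric G d"
proof -
  interpret group G by fact
  define f where "f = to_nat_on (carrier G)"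
  have f: "inj_on f (carrier G)" unfolding f_def by (rule inj_on_to_nat_on[OF ctbl])
  define w where "w g = Suc (f g + f (inv\<^bsub>G\<^esub> g))" for g
  have w_inv: "w (inv\<^bsub>G\<^esub> g) = w g" if "g \<in> carrier G" for g
    using that by (simp add: w_def)
  have w_fin: "finite {g\<in>carrier G. w g \<le> k}" for k
  proof (rule finite_imageD)
    have "f ` {g\<in>carrier G. w g \<le> k} \<subseteq> {..k}" by (auto simp: w_def)
    then show "finite (f ` {g\<in>carrier G. w g \<le> k})" by (rule finite_subset) simp
    show "inj_on f {g\<in>carrier G. w g \<le> k}" using f by (rule inj_on_subset) auto
  qed
  define p where "p ws = foldr (\<otimes>\<^bsub>G\<^esub>) ws \<one>\<^bsub>G\<^esub>" for ws
  have p_simps[simp]: "p [] = \<one>\<^bsub>G\<^esub>" "p (g # ws) = g \<otimes>\<^bsub>G\<^esub> p ws" for g ws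
    by (simp_all add: p_def)
  have p_closed[simp]: "set ws \<subseteq> carrier G \<Longrightarrow> p ws \<in> carrier G" for ws
    by (induction ws) auto
  have p_append: "set us \<subseteq> carrier G \<Longrightarrow> set vs \<subseteq> carrier G \<Longrightarrow> p (us @ vs) = p us \<otimes>\<^bsub>G\<^esub> p vs"
    for us vs by (induction us) (auto simp: m_assoc)
  have p_inv: "set ws \<subseteq> carrier G \<Longrightarrow> p (rev (map (m_inv G) ws)) = inv\<^bsub>G\<^esub> p ws" for ws
  proof (induction ws)
    case (Cons g ws)
    have "p (rev (map (m_inv G) ws) @ [inv\<^bsub>G\<^esub> g]) = p (rev (map (m_inv G) ws)) \<otimes>\<^bsub>G\<^esub> p [inv\<^bsub>G\<^esub> g]"
      using Cons.prems by (intro p_append) auto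
    with Cons show ?case by (simp add: inv_mult_group)
  qed simp
  define l where "l ws = sum_list (map w ws)" for ws
  define P where "P g k \<longleftrightarrow> (\<exists>ws. set ws \<subseteq> carrier G \<and> p ws = g \<and> l ws = k)" for g k
  define N where "N g = (LEAST k. P g k)" for g
  have P_N: "P g (N g)" if "g \<in> carrier G" for g
    unfolding N_def by (rule LeastI[of _ "w g"]) (use that in \<open>auto simp: P_def l_def intro!: exI[of _ "[g]"]\<close>)
  have N_le: "P g k \<Longrightarrow> N g \<le> k" for g k
    unfolding N_def by (rule Least_le)
  have N_one: "N \<one>\<^bsub>G\<^esub> = 0"
  proof -
    have "P \<one>\<^bsub>G\<^esub> 0" unfolding P_def by (intro exI[of _ "[]"]) (simp add: l_def)
    then show ?thesis using N_le by force
  qed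
  have len: "length ws \<le> l ws" for ws
    by (induction ws) (auto simp: l_def w_def)
  have N_zero: "g = \<one>\<^bsub>G\<^esub>" if "g \<in> carrier G" "N g = 0" for g
    using P_N[OF that(1)] that(2) len by (auto simp: P_def) (metis le_zero_eq length_0_conv p_simps(1))
  have N_mult: "N (g \<otimes>\<^bsub>G\<^esub> h) \<le> N g + N h" if gh: "g \<in> carrier G" "h \<in> carrier G" for g h
  proof -
    obtain us vs where "set us \<subseteq> carrier G" "p us = g" "l us = N g"
      "set vs \<subseteq> carrier G" "p vs = h" "l vs = N h"
      using P_N[OF gh(1)] P_N[OF gh(2)] by (auto simp: P_def)
    then have "P (g \<otimes>\<^bsub>G\<^esub> h) (N g + N h)"
      unfolding P_def by (intro exI[of _ "us @ vs"]) (auto simp: p_append l_def)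
    then show ?thesis by (rule N_le)
  qed
  have N_inv_le: "N (inv\<^bsub>G\<^esub> g) \<le> N g" if g: "g \<in> carrier G" for g
  proof -
    obtain us where us: "set us \<subseteq> carrier G" "p us = g" "l us = N g"
      using P_N[OF g] by (auto simp: P_def)
    have "map (w \<circ> m_inv G) us = map w us"
      using us(1) w_inv by (intro map_cong) auto
    then have "l (rev (map (m_inv G) us)) = l us"
      by (simp add: l_def rev_map[symmetric] del: map_eq_conv)
    then have "P (inv\<^bsub>G\<^esub> g) (N g)"
      unfolding P_def using us p_inv[OF us(1)] by (intro exI[of _ "rev (map (m_inv G) us)"]) auto
    then show ?thesis by (rule N_le)
  qed
  have N_inv: "N (inv\<^bsub>G\<^esub> g) = N g" if "g \<in> carrier G" for g
    using N_inv_le[OF that] N_inv_le[of "inv\<^bsub>G\<^esub> g"] that by simp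
  have elem_le: "g \<in> set ws \<Longrightarrow> w g \<le> l ws" for g ws
    by (induction ws) (auto simp: l_def)
  have N_fin: "finite {g\<in>carrier G. N g \<le> k}" for k
  proof (rule finite_subset)
    let ?W = "{ws. set ws \<subseteq> {g\<in>carrier G. w g \<le> k} \<and> length ws \<le> k}"
    show "{g\<in>carrier G. N g \<le> k} \<subseteq> p ` ?W"
    proof
      fix g assume "g \<in> {g\<in>carrier G. N g \<le> k}"
      then obtain us where us: "set us \<subseteq> carrier G" "p us = g" "l us \<le> k"
        using P_N[of g] by (auto simp: P_def)
      then have "us \<in> ?W" using elem_le[of _ us] len[of us] by fastforce
      with us(2) show "g \<in> p ` ?W" by blast
    qed
    show "finite (p ` ?W)"
      by (intro finite_imageI finite_lists_length_le w_fin)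
  qed
  define d where "d x y = (if x \<in> carrier G \<and> y \<in> carrier G then real (N (inv\<^bsub>G\<^esub> x \<otimes>\<^bsub>G\<^esub> y)) else 0)" for x y
  have metric: "Metric_space (carrier G) d"
  proof
    show "0 \<le> d x y" for x y by (simp add: d_def)
    show "d x y = d y x" for x y
      using N_inv[of "inv\<^bsub>G\<^esub> x \<otimes>\<^bsub>G\<^esub> y"] by (auto simp: d_def inv_mult_group)
    show "d x y = 0 \<longleftrightarrow> x = y" if xy: "x \<in> carrier G" "y \<in> carrier G" for x y
    proof
      assume "d x y = 0"
      with N_zero[of "inv\<^bsub>G\<^esub> x \<otimes>\<^bsub>G\<^esub> y"] xy have "inv\<^bsub>G\<^esub> x \<otimes>\<^bsub>G\<^esub> y = \<one>\<^bsub>G\<^esub>" by (simp add: d_def)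
      then show "x = y" using xy by (metis inv_closed inv_equality inv_inv)
    qed (use xy N_one in \<open>simp add: d_def\<close>)
    show "d x z \<le> d x y + d y z"
      if xyz: "x \<in> carrier G" "y \<in> carrier G" "z \<in> carrier G" for x y z
    proof -
      have "(inv\<^bsub>G\<^esub> x \<otimes>\<^bsub>G\<^esub> y) \<otimes>\<^bsub>G\<^esub> (inv\<^bsub>G\<^esub> y \<otimes>\<^bsub>G\<^esub> z) = inv\<^bsub>G\<^esub> x \<otimes>\<^bsub>G\<^esub> z"
        using xyz by (metis inv_closed inv_solve_left m_assoc m_closed)
      with N_mult[of "inv\<^bsub>G\<^esub> x \<otimes>\<^bsub>G\<^esub> y" "inv\<^bsub>G\<^esub> y \<otimes>\<^bsub>G\<^esub> z"] xyz show ?thesis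
        by (simp add: d_def)
    qed
  qed
  have "d (g \<otimes>\<^bsub>G\<^esub> x) (g \<otimes>\<^bsub>G\<^esub> y) = d x y"
    if "g \<in> carrier G" "x \<in> carrier G" "y \<in> carrier G" for g x y
  proof -
    have "inv\<^bsub>G\<^esub> (g \<otimes>\<^bsub>G\<^esub> x) \<otimes>\<^bsub>G\<^esub> (g \<otimes>\<^bsub>G\<^esub> y) = inv\<^bsub>G\<^esub> x \<otimes>\<^bsub>G\<^esub> y"
      using that by (metis inv_closed inv_mult_group inv_solve_left m_assoc m_closed)
    with that show ?thesis by (simp add: d_def)
  qed
  moreover have "finite (Metric_space.mcball (carrier G) d x r)" if x: "x \<in> carrier G" for x r
  proof (rule finite_subset)
    show "finite ((\<lambda>g. x \<otimes>\<^bsub>G\<^esub> g) ` {g\<in>carrier G. N g \<le> nat \<lfloor>r\<rfloor>})"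
      by (intro finite_imageI N_fin)
    show "Metric_space.mcball (carrier G) d x r \<subseteq> (\<lambda>g. x \<otimes>\<^bsub>G\<^esub> g) ` {g\<in>carrier G. N g \<le> nat \<lfloor>r\<rfloor>}"
    proof
      fix y assume "y \<in> Metric_space.mcball (carrier G) d x r"
      then have y: "y \<in> carrier G" "real (N (inv\<^bsub>G\<^esub> x \<otimes>\<^bsub>G\<^esub> y)) \<le> r"
        using x by (auto simp: Metric_space.in_mcball[OF metric] d_def)
      then have "N (inv\<^bsub>G\<^esub> x \<otimes>\<^bsub>G\<^esub> y) \<le> nat \<lfloor>r\<rfloor>" by linarith
      moreover have "y = x \<otimes>\<^bsub>G\<^esub> (inv\<^bsub>G\<^esub> x \<otimes>\<^bsub>G\<^esub> y)"
        using x y by (simp add: m_assoc[symmetric])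
      ultimately show "y \<in> (\<lambda>g. x \<otimes>\<^bsub>G\<^esub> g) ` {g\<in>carrier G. N g \<le> nat \<lfloor>r\<rfloor>}"
        using x y by blast
    qed
  qed
  ultimately show ?thesis
    using metric by (auto simp: proper_left_invariant_metric_def left_invariant_metric_def)
qed

end

theory Submission
  imports Defs
begin

text \<open>
  Fix one proper left invariant metric \<open>d\<close> on \<open>G\<close>. Its restriction to a subgroup \<open>F\<close> is again proper
  and left invariant, so \<open>asdim F\<close> may be computed with \<open>d\<close> itself, and \<open>asdim F \<le> asdim G\<close> is
  monotonicity of asymptotic dimension under passing to subsets.

  Conversely, suppose that \<open>asdim F \<le> n\<close> for all finitely generated subgroups \<open>F\<close>, and fix a scale
  \<open>r\<close>. By properness the elements at distance at most \<open>r\<close> from the identity form a finite set, which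
  generates a subgroup \<open>F\<close>. If \<open>d x y \<le> r\<close> then \<open>x\<inverse>y\<close> lies in that ball, hence in \<open>F\<close>: distinct
  left cosets of \<open>F\<close> are more than \<open>r\<close> apart. Left translations are isometries, so each coset carries
  a copy of a cover of \<open>F\<close> by \<open>n + 1\<close> families that are \<open>r\<close>-disjoint and uniformly bounded, with a
  bound independent of the coset. The union of these copies over a transversal is a cover of \<open>G\<close>
  of the same kind (\<open>coarse_cover_of_cosets\<close>). The subgroup \<open>F\<close> depends on \<open>r\<close>, but the number
  \<open>n + 1\<close> of families does not, which is all that \<open>asdim G \<le> n\<close> requires.
\<close>

text \<open>The body of \<open>asdim_at_most\<close> at one fixed scale \<open>r\<close>, isolated because the subgroup that is used
  to cover \<open>G\<close> changes with the scale.\<close>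

definition coarse_cover ::
  "'a set \<Rightarrow> ('a \<Rightarrow> 'a \<Rightarrow> real) \<Rightarrow> nat \<Rightarrow> real \<Rightarrow> real \<Rightarrow> (nat \<Rightarrow> 'a set set) \<Rightarrow> bool" where
  "coarse_cover M d n r R \<U> \<longleftrightarrow>
     (\<forall>i\<le>n. \<U> i \<subseteq> Pow M \<and> bounded_family d R (\<U> i) \<and> disjoint_family_at d r (\<U> i)) \<and>
     M \<subseteq> (\<Union>i\<le>n. \<Union>(\<U> i))"

lemma asdim_at_most_iff_coarse_cover:
  "asdim_at_most M d n \<longleftrightarrow> (\<forall>r>0. \<exists>R \<U>. coarse_cover M d n r R \<U>)"
  unfolding asdim_at_most_def coarse_cover_def ..

lemma asdim_at_most_mono:
  assumes "asdim_at_most M d m" and "m \<le> n"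
  shows "asdim_at_most M d n"
  unfolding asdim_at_most_iff_coarse_cover
proof (intro allI impI)
  fix r :: real assume "r > 0"
  then obtain R \<U> where U: "coarse_cover M d m r R \<U>"
    using assms(1) unfolding asdim_at_most_iff_coarse_cover by blast
  have "coarse_cover M d n r R (\<lambda>i. if i \<le> m then \<U> i else {})"
    unfolding coarse_cover_def
  proof (intro conjI allI impI)
    show "M \<subseteq> (\<Union>i\<le>n. \<Union>(if i \<le> m then \<U> i else {}))"
    proof
      fix x assume "x \<in> M"
      then obtain i A where "i \<le> m" "A \<in> \<U> i" "x \<in> A"
        using U unfolding coarse_cover_def by blast
      then show "x \<in> (\<Union>i\<le>n. \<Union>(if i \<le> m then \<U> i else {}))"
        using \<open>m \<le> n\<close> by (intro UN_I[of i]) auto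
    qed
  qed (use U in \<open>simp_all add: coarse_cover_def bounded_family_def disjoint_family_at_def\<close>)
  then show "\<exists>R \<U>. coarse_cover M d n r R \<U>" by blast
qed

text \<open>A finite infimum of extended naturals is attained, and the admissible \<open>n\<close> are upward closed;
  this turns inequalities between values of \<open>asdim\<close> into statements about covers.\<close>

lemma asdim_le_enat_iff: "asdim M d \<le> enat n \<longleftrightarrow> asdim_at_most M d n"
proof
  assume le: "asdim M d \<le> enat n"
  let ?S = "enat ` {m. asdim_at_most M d m}"
  have "?S \<noteq> {}"
    using le by (cases "{m. asdim_at_most M d m} = {}") (simp_all add: asdim_def Inf_enat_def)
  then have "Inf ?S \<in> ?S"
    unfolding Inf_enat_def by (auto intro: LeastI)
  then show "asdim_at_most M d n"
    using le asdim_at_most_mono by (auto simp: asdim_def)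
next
  assume "asdim_at_most M d n"
  then show "asdim M d \<le> enat n"
    unfolding asdim_def by (intro INF_lower) simp
qed

lemma asdim_at_most_subset:
  assumes "asdim_at_most M d n" and "N \<subseteq> M"
  shows "asdim_at_most N d n"
  unfolding asdim_at_most_iff_coarse_cover
proof (intro allI impI)
  fix r :: real assume "r > 0"
  then obtain R \<U> where U: "coarse_cover M d n r R \<U>"
    using assms(1) unfolding asdim_at_most_iff_coarse_cover by blast
  have "coarse_cover N d n r R (\<lambda>i. (\<lambda>A. A \<inter> N) ` \<U> i)"
    unfolding coarse_cover_def
  proof (intro conjI allI impI)
    fix i assume "i \<le> n"
    then have b: "bounded_family d R (\<U> i)" and s: "disjoint_family_at d r (\<U> i)"
      using U by (auto simp: coarse_cover_def)
    show "bounded_family d R ((\<lambda>A. A \<inter> N) ` \<U> i)"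
      using b by (auto simp: bounded_family_def)
    show "disjoint_family_at d r ((\<lambda>A. A \<inter> N) ` \<U> i)"
      using s unfolding disjoint_family_at_def by blast
  next
    have "N \<subseteq> (\<Union>i\<le>n. \<Union>(\<U> i)) \<inter> N"
      using U \<open>N \<subseteq> M\<close> unfolding coarse_cover_def by blast
    then show "N \<subseteq> (\<Union>i\<le>n. \<Union>((\<lambda>A. A \<inter> N) ` \<U> i))" by auto
  qed auto
  then show "\<exists>R \<U>. coarse_cover N d n r R \<U>" by blast
qed

lemma asdim_subset_le:
  assumes "N \<subseteq> M"
  shows "asdim N d \<le> asdim M d"
proof (cases "asdim M d")
  case (enat n)
  then have "asdim_at_most M d n" by (simp flip: asdim_le_enat_iff)
  then have "asdim_at_most N d n" using assms by (rule asdim_at_most_subset)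
  then show ?thesis using enat by (simp add: asdim_le_enat_iff)
qed simp

lemma proper_left_invariant_metric_subgroup:
  assumes "subgroup F G" and d: "proper_left_invariant_metric G d"
  shows "proper_left_invariant_metric (G\<lparr>carrier := F\<rparr>) d"
proof -
  have sub: "F \<subseteq> carrier G" using assms(1) by (rule subgroup.subset)
  interpret G: Metric_space "carrier G" d
    using d by (simp add: proper_left_invariant_metric_def left_invariant_metric_def)
  interpret F: Metric_space F d
    using sub by (rule G.subspace)
  have "finite (F.mcball x r)" if "x \<in> F" for x r
  proof (rule finite_subset)
    show "F.mcball x r \<subseteq> G.mcball x r" using sub by auto
    show "finite (G.mcball x r)"
      using d sub that by (auto simp: proper_left_invariant_metric_def)
  qed
  then show ?thesis
    using d sub F.Metric_space_axioms
    by (auto simp: proper_left_invariant_metric_def left_invariant_metric_def subset_iff)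
qed

lemma group_asdim_subgroup:
  assumes "group G" and "subgroup F G" and "proper_left_invariant_metric G d"
  shows "group_asdim (G\<lparr>carrier := F\<rparr>) = asdim F d"
  using group_asdim_eq[OF subgroup.subgroup_is_group proper_left_invariant_metric_subgroup] assms
  by fastforce

lemma (in group) left_transversal_exists:
  assumes H: "subgroup H G"
  obtains T where "T \<subseteq> carrier G"
    and "\<And>x. x \<in> carrier G \<Longrightarrow> \<exists>t\<in>T. \<exists>h\<in>H. x = t \<otimes> h"
    and "\<And>s t. s \<in> T \<Longrightarrow> t \<in> T \<Longrightarrow> inv s \<otimes> t \<in> H \<Longrightarrow> s = t"
proof -
  interpret H: subgroup H G by (rule H)
  define rep where "rep C = (SOME y. y \<in> C)" for C :: "'a set"
  have self: "x \<in> x <# H" if "x \<in> carrier G" for x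
    using that H.one_closed unfolding l_coset_def by force
  define T where "T = (\<lambda>x. rep (x <# H)) ` carrier G"
  have rep: "rep (x <# H) \<in> x <# H" if "x \<in> carrier G" for x
    unfolding rep_def using self[OF that] by (rule someI)
  have T: "T \<subseteq> carrier G"
    using rep l_coset_subset_G[OF H.subset] unfolding T_def by blast
  have T_rep: "rep (t <# H) = t" if "t \<in> T" for t
    using that l_repr_independence[OF rep _ H] unfolding T_def by force
  show thesis
  proof (rule that[OF T])
    fix x assume x: "x \<in> carrier G"
    define t where "t = rep (x <# H)"
    have "t \<in> T" using x by (simp add: t_def T_def)
    moreover have "x \<in> t <# H"
      using l_repr_independence[OF rep[OF x] x H] self[OF x] by (simp add: t_def)
    ultimately show "\<exists>t\<in>T. \<exists>h\<in>H. x = t \<otimes> h"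
      unfolding l_coset_def by blast
  next
    fix s t assume st: "s \<in> T" "t \<in> T" "inv s \<otimes> t \<in> H"
    then have "s \<in> carrier G" "t \<in> carrier G" using T by auto
    then have "t = s \<otimes> (inv s \<otimes> t)" by (simp flip: m_assoc)
    then have "t \<in> s <# H" using st(3) unfolding l_coset_def by blast
    then have "s <# H = t <# H"
      using \<open>s \<in> carrier G\<close> H by (rule l_repr_independence)
    then show "s = t" using T_rep st by metis
  qed
qed

text \<open>Two translates \<open>s <# A\<close> and \<open>t <# B\<close> of members of the given families lie in the same coset only
  if \<open>s = t\<close>, and then \<open>sa\<close> and \<open>sb\<close> are as far apart as \<open>a\<close> and \<open>b\<close>; in different cosets they are
  more than \<open>r\<close> apart because \<open>H\<close> contains the \<open>r\<close>-ball around the identity. It is essential to translate by a transversal only: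
  translates of \<open>A\<close> by two elements of the same coset could overlap without being equal.\<close>

lemma coarse_cover_of_cosets:
  fixes G (structure)
  assumes "group G" and d: "left_invariant_metric G d" and H: "subgroup H G"
    and ball: "\<And>g. g \<in> carrier G \<Longrightarrow> d \<one> g \<le> r \<Longrightarrow> g \<in> H"
    and U: "coarse_cover H d n r R \<U>"
  shows "\<exists>\<V>. coarse_cover (carrier G) d n r R \<V>"
proof -
  interpret group G by fact
  interpret H: subgroup H G by (rule H)
  have inv: "d (g \<otimes> x) (g \<otimes> y) = d x y"
    if "g \<in> carrier G" "x \<in> carrier G" "y \<in> carrier G" for g x y
    using d that by (simp add: left_invariant_metric_def)
  obtain T where T: "T \<subseteq> carrier G"
    and ex: "\<And>x. x \<in> carrier G \<Longrightarrow> \<exists>t\<in>T. \<exists>h\<in>H. x = t \<otimes> h"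
    and uniq: "\<And>s t. s \<in> T \<Longrightarrow> t \<in> T \<Longrightarrow> inv s \<otimes> t \<in> H \<Longrightarrow> s = t"
    using left_transversal_exists[OF H] by metis
  have same_coset: "s = t"
    if st: "s \<in> T" "t \<in> T" and ab: "a \<in> H" "b \<in> H" and near: "d (s \<otimes> a) (t \<otimes> b) \<le> r" for s t a b
  proof (rule uniq[OF st])
    have c: "s \<in> carrier G" "t \<in> carrier G" "a \<in> carrier G" "b \<in> carrier G"
      using st T ab by auto
    define g where "g = inv (s \<otimes> a) \<otimes> (t \<otimes> b)"
    have g: "g \<in> carrier G" using c by (simp add: g_def)
    have "(s \<otimes> a) \<otimes> g = t \<otimes> b" using c by (simp add: g_def flip: m_assoc)
    then have "d \<one> g = d (s \<otimes> a) (t \<otimes> b)"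
      using inv[of "s \<otimes> a" \<one> g] c g by simp
    then have "g \<in> H" using ball g near by simp
    then have "a \<otimes> g \<otimes> inv b \<in> H" using ab by simp
    also have "a \<otimes> g \<otimes> inv b = inv s \<otimes> t"
      using c by (simp add: g_def inv_mult_group m_assoc inv_solve_left')
         (simp flip: m_assoc)
    finally show "inv s \<otimes> t \<in> H" .
  qed
  define \<V> where "\<V> i = {t <# A |t A. t \<in> T \<and> A \<in> \<U> i}" for i
  have "coarse_cover (carrier G) d n r R \<V>"
    unfolding coarse_cover_def
  proof (intro conjI allI impI)
    fix i assume "i \<le> n"
    then have sub: "\<U> i \<subseteq> Pow H" and bd: "bounded_family d R (\<U> i)"
      and dj: "disjoint_family_at d r (\<U> i)"
      using U by (auto simp: coarse_cover_def)
    have isom: "d (t \<otimes> a) (t \<otimes> b) = d a b" if "t \<in> T" "a \<in> H" "b \<in> H" for t a b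
      using that T by (intro inv) auto
    show "\<V> i \<subseteq> Pow (carrier G)"
      using sub T by (fastforce simp: \<V>_def l_coset_def)
    show "bounded_family d R (\<V> i)"
      unfolding bounded_family_def
    proof (intro ballI)
      fix A x y assume "A \<in> \<V> i" "x \<in> A" "y \<in> A"
      then obtain t B a b where "t \<in> T" "B \<in> \<U> i" "a \<in> B" "b \<in> B" "x = t \<otimes> a" "y = t \<otimes> b"
        by (auto simp: \<V>_def l_coset_def)
      moreover from this have "a \<in> H" "b \<in> H" using sub by auto
      ultimately show "d x y \<le> R" using bd by (simp add: isom bounded_family_def)
    qed
    show "disjoint_family_at d r (\<V> i)"
      unfolding disjoint_family_at_def
    proof (intro ballI impI)
      fix C D x y assume CD: "C \<in> \<V> i" "D \<in> \<V> i" "C \<noteq> D" and xy: "x \<in> C" "y \<in> D"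
      obtain s A a where s: "s \<in> T" "A \<in> \<U> i" "a \<in> A" "C = s <# A" "x = s \<otimes> a"
        using CD(1) xy(1) by (auto simp: \<V>_def l_coset_def)
      obtain t B b where t: "t \<in> T" "B \<in> \<U> i" "b \<in> B" "D = t <# B" "y = t \<otimes> b"
        using CD(2) xy(2) by (auto simp: \<V>_def l_coset_def)
      have ab: "a \<in> H" "b \<in> H" using s t sub by auto
      show "d x y > r"
      proof (rule ccontr)
        assume near: "\<not> d x y > r"
        then have "s = t" using same_coset s t ab by simp
        then have "A \<noteq> B" using CD(3) s t by auto
        then have "d a b > r" using dj s t by (auto simp: disjoint_family_at_def)
        then show False using near isom[OF t(1) ab] s t \<open>s = t\<close> by simp
      qed
    qed
  next
    show "carrier G \<subseteq> (\<Union>i\<le>n. \<Union>(\<V> i))"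
    proof
      fix x assume "x \<in> carrier G"
      then obtain t h where th: "t \<in> T" "h \<in> H" "x = t \<otimes> h" using ex by blast
      then obtain i A where "i \<le> n" "A \<in> \<U> i" "h \<in> A"
        using U unfolding coarse_cover_def by blast
      then have "t <# A \<in> \<V> i" "x \<in> t <# A"
        using th by (auto simp: \<V>_def l_coset_def)
      then show "x \<in> (\<Union>i\<le>n. \<Union>(\<V> i))" using \<open>i \<le> n\<close> by blast
    qed
  qed
  then show ?thesis by blast
qed

text \<open>Properness enters here: the closed \<open>r\<close>-ball around the identity is finite, so the subgroup that
  it generates is one of those for which the bound \<open>n\<close> is assumed.\<close>

lemma asdim_at_most_if_finitely_generated_subgroups:
  assumes G: "group G" and d: "proper_left_invariant_metric G d"
    and fg: "\<And>F. finitely_generated_subgroup F G \<Longrightarrow> asdim_at_most F d n"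
  shows "asdim_at_most (carrier G) d n"
  unfolding asdim_at_most_iff_coarse_cover
proof (intro allI impI)
  fix r :: real assume "r > 0"
  interpret group G by fact
  interpret Metric_space "carrier G" d
    using d by (simp add: proper_left_invariant_metric_def left_invariant_metric_def)
  let ?S = "mcball \<one>\<^bsub>G\<^esub> r"
  define F where "F = generate G ?S"
  have "finite ?S" using d by (simp add: proper_left_invariant_metric_def)
  moreover have "?S \<subseteq> carrier G" by auto
  moreover from this have F: "subgroup F G"
    unfolding F_def by (rule generate_is_subgroup)
  ultimately have "finitely_generated_subgroup F G"
    unfolding finitely_generated_subgroup_def F_def by blast
  then obtain R \<U> where U: "coarse_cover F d n r R \<U>"
    using fg \<open>r > 0\<close> unfolding asdim_at_most_iff_coarse_cover by blast
  have "g \<in> F" if "g \<in> carrier G" "d \<one>\<^bsub>G\<^esub> g \<le> r" for g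
    unfolding F_def using that by (intro generate.incl) simp
  then show "\<exists>R \<U>. coarse_cover (carrier G) d n r R \<U>"
    using coarse_cover_of_cosets[OF G _ F _ U] d
    unfolding proper_left_invariant_metric_def by blast
qed

theorem theorem2p1:
  fixes G :: "('a, 'b) monoid_scheme"
  assumes "group G" and "countable (carrier G)"
  shows "group_asdim G =
    (SUP F\<in>{F. finitely_generated_subgroup F G}. group_asdim (G\<lparr>carrier := F\<rparr>))"
proof -
  obtain d where d: "proper_left_invariant_metric G d"
    using proper_left_invariant_metric_exists[OF assms] by blast
  have asdim_G: "group_asdim G = asdim (carrier G) d"
    using assms(1) d by (rule group_asdim_eq)
  have asdim_F: "group_asdim (G\<lparr>carrier := F\<rparr>) = asdim F d"
    if "finitely_generated_subgroup F G" for F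
    using that assms(1) d by (intro group_asdim_subgroup) (auto simp: finitely_generated_subgroup_def)
  let ?sup = "SUP F\<in>{F. finitely_generated_subgroup F G}. group_asdim (G\<lparr>carrier := F\<rparr>)"
  show ?thesis
  proof (rule antisym)
    show "group_asdim G \<le> ?sup"
    proof (cases ?sup)
      case (enat n)
      have "asdim_at_most F d n" if F: "finitely_generated_subgroup F G" for F
      proof -
        have "group_asdim (G\<lparr>carrier := F\<rparr>) \<le> ?sup" using F by (intro SUP_upper) simp
        then have "asdim F d \<le> enat n" unfolding enat asdim_F[OF F] .
        then show ?thesis by (simp only: asdim_le_enat_iff)
      qed
      then have "asdim_at_most (carrier G) d n"
        by (rule asdim_at_most_if_finitely_generated_subgroups[OF assms(1) d])
      then show ?thesis unfolding enat asdim_G asdim_le_enat_iff .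
    qed simp
    show "?sup \<le> group_asdim G"
    proof (rule SUP_least)
      fix F assume "F \<in> {F. finitely_generated_subgroup F G}"
      then have F: "finitely_generated_subgroup F G" by simp
      then have "F \<subseteq> carrier G"
        by (auto simp: finitely_generated_subgroup_def dest: subgroup.subset)
      then show "group_asdim (G\<lparr>carrier := F\<rparr>) \<le> group_asdim G"
        unfolding asdim_F[OF F] asdim_G by (rule asdim_subset_le)
    qed
  qed
qed

end
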